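(* Let $n\ge 1$ be an integer, let $\alpha_1,\dots,\alpha_{n+1}>0$ be real numbers and let $\nu_1,\dots,\nu_n\in\mathbb{C}$; put $\alpha_0=\nu_0=0$. Then the multiple parameters generalized Wright function $$\mathcal{W}^{(\bar\alpha,\bar\nu)}(z)=\sum_{k=0}^{\infty}\left(\prod_{i=1}^{k}\prod_{j=1}^{n}\frac{\Gamma(\alpha_{n+1}i+a_j)}{\Gamma(\alpha_{n+1}i+b_j)}\right)\frac{z^k}{\Gamma(\alpha_{n+1}k+b_{n+1})},$$ where $$a_j=1+\sum_{m=1}^{j}(\nu_{m-1}-\alpha_m),\qquad b_j=1+\sum_{m=1}^{j}(\nu_{m-1}-\alpha_{m-1}),$$ is an entire function of the complex variable $z$.
   Context: $\Gamma$ denotes the Euler Gamma function; $\bar\alpha=(\alpha_1,\dots,\alpha_{n+1})$ and $\bar\nu=(\nu_1,\dots,\nu_n)$. The empty product (for $k=0$) equals $1$. *)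

theory Defs
  imports "HOL-Complex_Analysis.Complex_Analysis"
begin

text \<open>
  A parameter tuple is a function on \<open>nat\<close>, used at the indices \<open>0, \<dots>, n + 1\<close> for \<open>\<alpha>\<close> and
  \<open>0, \<dots>, n\<close> for \<open>\<nu>\<close>; the convention \<open>\<alpha> 0 = 0\<close>, \<open>\<nu> 0 = 0\<close> is not built into the definitions
  and has to be assumed where they are used.
\<close>

definition wright_a :: "(nat \<Rightarrow> real) \<Rightarrow> (nat \<Rightarrow> complex) \<Rightarrow> nat \<Rightarrow> complex" where
  "wright_a \<alpha> \<nu> j = 1 + (\<Sum>m = 1..j. \<nu> (m - 1) - of_real (\<alpha> m))"

definition wright_b :: "(nat \<Rightarrow> real) \<Rightarrow> (nat \<Rightarrow> complex) \<Rightarrow> nat \<Rightarrow> complex" where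
  "wright_b \<alpha> \<nu> j = 1 + (\<Sum>m = 1..j. \<nu> (m - 1) - of_real (\<alpha> (m - 1)))"

text \<open>
  At its poles the library function \<^const>\<open>Gamma\<close> has the value 0, and division by 0 gives 0.
  A pole in a denominator is therefore treated in the usual way, by \<open>1 / \<Gamma> = 0\<close>.  At a pole of
  some \<open>\<Gamma>(\<alpha>\<^bsub>n+1\<^esub> i + a\<^bsub>j\<^esub>)\<close> in a numerator the series has no conventional meaning; here that
  factor is 0.
\<close>

definition wright_term ::
  "nat \<Rightarrow> (nat \<Rightarrow> real) \<Rightarrow> (nat \<Rightarrow> complex) \<Rightarrow> complex \<Rightarrow> nat \<Rightarrow> complex" where
  "wright_term n \<alpha> \<nu> z k =
     (\<Prod>i = 1..k. \<Prod>j = 1..n.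
        Gamma (of_real (\<alpha> (n + 1)) * of_nat i + wright_a \<alpha> \<nu> j) /
        Gamma (of_real (\<alpha> (n + 1)) * of_nat i + wright_b \<alpha> \<nu> j)) *
     (z ^ k / Gamma (of_real (\<alpha> (n + 1)) * of_nat k + wright_b \<alpha> \<nu> (n + 1)))"

definition wright_W ::
  "nat \<Rightarrow> (nat \<Rightarrow> real) \<Rightarrow> (nat \<Rightarrow> complex) \<Rightarrow> complex \<Rightarrow> complex" where
  "wright_W n \<alpha> \<nu> z = (\<Sum>k. wright_term n \<alpha> \<nu> z k)"

end

theory Submission
  imports Defs
begin

text \<open>
  The ratio \<open>\<Gamma>(z) / \<Gamma>(z + s)\<close> with \<open>s > 0\<close> is dominated by its value at \<open>Re z\<close>, which is seen
  factor by factor in Euler's limit formula, and on the real axis log-convexity bounds it by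
  \<open>(x - 1)\<^sup>-\<^sup>s\<close>.  Since \<open>b\<^sub>j = a\<^sub>j + \<alpha>\<^sub>j\<close>, the quotient of consecutive coefficients of the series is a
  product of such ratios, all of which tend to 0; so the ratio test applies at every \<open>z\<close>.
\<close>

lemma norm_Gamma_ratio_le:
  fixes z :: complex and s :: real
  assumes "Re z > 0" "s \<ge> 0"
  shows "norm (Gamma z / Gamma (z + of_real s)) \<le> Gamma (Re z) / Gamma (Re z + s)"
proof (rule LIMSEQ_le)
  have pos: "z + of_real s \<notin> \<int>\<^sub>\<le>\<^sub>0" "Re z + s \<notin> \<int>\<^sub>\<le>\<^sub>0"
    using assms by (auto elim!: nonpos_Ints_cases simp: complex_eq_iff)
  show "(\<lambda>N. norm (Gamma_series z N / Gamma_series (z + of_real s) N))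
          \<longlonglongrightarrow> norm (Gamma z / Gamma (z + of_real s))"
    using pos by (intro tendsto_intros) (simp add: Gamma_eq_zero_iff)
  show "(\<lambda>N. Gamma_series (Re z) N / Gamma_series (Re z + s) N)
          \<longlonglongrightarrow> Gamma (Re z) / Gamma (Re z + s)"
    using pos by (intro tendsto_intros) (simp add: Gamma_eq_zero_iff)
  \<comment> \<open>The factorials cancel and the powers of \<open>N\<close> leave
    \<open>exp (- s * ln N)\<close>, the same positive factor for \<open>z\<close> and for
    \<open>Re z\<close>; only the finite products remain to be compared. The type of
    \<open>w\<close> is left general so that both cases are instances.\<close>
  have quotient: "Gamma_series w N / Gamma_series (w + of_real s) N =
      exp (- of_real (s * ln (real N))) *
      (\<Prod>k = 0..N. (w + of_real s + of_nat k) / (w + of_nat k))"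
    for w :: "'a :: {banach, real_normed_field}" and N
    by (simp add: Gamma_series_def pochhammer_Suc_prod prod_dividef ring_distribs exp_add
        exp_minus field_simps)
  have "norm (Gamma_series z N / Gamma_series (z + of_real s) N)
      \<le> Gamma_series (Re z) N / Gamma_series (Re z + s) N" for N
  proof -
    \<comment> \<open>Each factor is \<open>1 + s / (z + k)\<close>, and \<open>z + k\<close> has
      norm at least its positive real part \<open>Re z + k\<close>.\<close>
    have "norm ((z + of_real s + of_nat k) / (z + of_nat k)) \<le> (Re z + s + real k) / (Re z + real k)"
      for k
    proof -
      have le: "Re z + real k \<le> norm (z + of_nat k)"
        using complex_Re_le_cmod[of "z + of_nat k"] by simp
      have nz: "z + of_nat k \<noteq> 0"
        using assms by (auto simp: complex_eq_iff)
      have "(z + of_real s + of_nat k) / (z + of_nat k) = 1 + of_real s / (z + of_nat k)"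
        using nz by (simp add: field_simps)
      also have "norm \<dots> \<le> 1 + s / norm (z + of_nat k)"
        using norm_triangle_ineq[of 1 "of_real s / (z + of_nat k)"] assms
        by (simp add: norm_divide)
      also have "\<dots> \<le> 1 + s / (Re z + real k)"
        using le assms by (intro add_left_mono divide_left_mono mult_pos_pos) auto
      also have "\<dots> = (Re z + s + real k) / (Re z + real k)"
        using assms by (simp add: field_simps)
      finally show ?thesis .
    qed
    then have "(\<Prod>k = 0..N. norm ((z + of_real s + of_nat k) / (z + of_nat k)))
        \<le> (\<Prod>k = 0..N. (Re z + s + real k) / (Re z + real k))"
      by (intro prod_mono) auto
    then show ?thesis
      using quotient[of z N] quotient[of "Re z" N]
      by (simp add: norm_mult prod_norm flip: exp_of_real of_real_minus)
  qed
  then show "\<exists>M. \<forall>N\<ge>M. norm (Gamma_series z N / Gamma_series (z + of_real s) N)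
      \<le> Gamma_series (Re z) N / Gamma_series (Re z + s) N"
    by blast
qed

text \<open>Slopes of the convex function \<open>ln \<circ> Gamma\<close> increase: the slope on
  \<open>[x - 1, x]\<close>, which is \<open>ln (x - 1)\<close> by the functional equation, is at
  most the slope on \<open>[x, x + s]\<close>.\<close>

lemma Gamma_real_ratio_le:
  fixes x s :: real
  assumes "x > 1" "s > 0"
  shows "Gamma x / Gamma (x + s) \<le> (x - 1) powr (- s)"
proof -
  let ?f = "\<lambda>t::real. ln (Gamma t)"
  have cv: "convex_on {0<..} (ln \<circ> Gamma :: real \<Rightarrow> real)"
    by (rule log_convex_Gamma_real)
  have mem: "x - 1 \<in> {0<..}" "x + s \<in> {0<..}"
    using assms by auto
  have "Gamma x = (x - 1) * Gamma (x - 1)"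
    using Gamma_plus1[of "x - 1"] assms nonpos_Ints_nonpos[of "x - 1"] by auto
  moreover have "Gamma (x - 1) \<noteq> 0"
    using Gamma_real_pos[of "x - 1"] assms by linarith
  ultimately have "ln (x - 1) = ?f x - ?f (x - 1)"
    using assms by (simp add: ln_mult)
  also have "\<dots> = (?f (x - 1) - ?f x) / (x - 1 - x)"
    by simp
  also have "\<dots> \<le> (?f x - ?f (x + s)) / (x - (x + s))"
    using convex_on_slope_le[OF cv mem, of x] assms by (simp add: o_def)
  finally have "ln (x - 1) * s \<le> ?f (x + s) - ?f x"
    using assms by (simp add: field_simps)
  then have "?f x - ?f (x + s) \<le> - s * ln (x - 1)"
    by (simp add: mult.commute)
  then have "exp (?f x - ?f (x + s)) \<le> exp (- s * ln (x - 1))"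
    by simp
  then show ?thesis
    using assms by (simp add: exp_diff powr_def)
qed

text \<open>The limit is taken along a real variable so that it can be composed with both
  progressions \<open>A * k\<close> and \<open>A * (k + 1)\<close> below.\<close>

lemma Gamma_ratio_tendsto_0:
  fixes a :: complex and s :: real
  assumes "s > 0"
  shows "((\<lambda>x. Gamma (of_real x + a) / Gamma (of_real x + a + of_real s)) \<longlongrightarrow> 0) at_top"
proof (rule Lim_null_comparison)
  have "eventually (\<lambda>x. x + Re a > 1) at_top"
    using eventually_gt_at_top[of "1 - Re a"] by eventually_elim simp
  then show "eventually (\<lambda>x. norm (Gamma (of_real x + a) / Gamma (of_real x + a + of_real s))
      \<le> (x + Re a - 1) powr (- s)) at_top"
  proof eventually_elim
    case (elim x)
    then show ?case
      using norm_Gamma_ratio_le[of "of_real x + a" s] Gamma_real_ratio_le[of "x + Re a" s] assms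
      by simp
  qed
  show "((\<lambda>x. (x + Re a - 1) powr (- s)) \<longlongrightarrow> 0) at_top"
    using assms by real_asymp
qed

text \<open>The ratio test in multiplicative form: terms of the series may vanish, at
  \<open>z = 0\<close> or through a pole of \<open>Gamma\<close>, so no quotient of terms is
  formed.\<close>

lemma summable_eventually_ratio:
  fixes f r :: "nat \<Rightarrow> complex"
  assumes "eventually (\<lambda>k. f (Suc k) = r k * f k) sequentially" "r \<longlonglongrightarrow> 0"
  shows "summable f"
proof -
  have "eventually (\<lambda>k. norm (r k) < 1/2) sequentially"
    using order_tendstoD(2)[OF tendsto_norm_zero[OF assms(2)], of "1/2"] by simp
  with assms(1) have "eventually (\<lambda>k. norm (f (Suc k)) \<le> 1/2 * norm (f k)) sequentially"
  proof eventually_elim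
    case (elim k)
    then show ?case
      using mult_right_mono[of "norm (r k)" "1/2" "norm (f k)"] by (simp add: norm_mult)
  qed
  then obtain N where "\<And>k. k \<ge> N \<Longrightarrow> norm (f (Suc k)) \<le> 1/2 * norm (f k)"
    by (auto simp: eventually_sequentially)
  then show ?thesis
    by (intro summable_ratio_test[of "1/2" N f]) auto
qed

text \<open>The \<nu> parts agree and the \<alpha> parts telescope down to
  \<open>\<alpha> 0 = 0\<close>. Thus each Gamma quotient in the coefficients is a ratio with the
  positive shift \<open>\<alpha> j\<close>.\<close>

lemma wright_b_eq:
  assumes "\<alpha> 0 = 0"
  shows "wright_b \<alpha> \<nu> j = wright_a \<alpha> \<nu> j + of_real (\<alpha> j)"
proof -
  have "(\<Sum>m = 1..j. \<alpha> m - \<alpha> (m - 1)) = \<alpha> j - \<alpha> 0"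
    by (induction j) auto
  then have "of_real (\<Sum>m = 1..j. \<alpha> m - \<alpha> (m - 1)) = (of_real (\<alpha> j) :: complex)"
    using assms by simp
  then show ?thesis
    by (simp add: wright_a_def wright_b_def sum_subtractf algebra_simps)
qed

lemma summable_wright_term:
  assumes pos: "\<And>m. 1 \<le> m \<Longrightarrow> m \<le> n + 1 \<Longrightarrow> \<alpha> m > 0" and "\<alpha> 0 = 0"
  shows "summable (wright_term n \<alpha> \<nu> z)"
proof -
  define A where "A = \<alpha> (n + 1)"
  define b where "b = wright_b \<alpha> \<nu> (n + 1)"
  define q where "q j x = Gamma (of_real x + wright_a \<alpha> \<nu> j) / Gamma (of_real x + wright_b \<alpha> \<nu> j)"
    for j and x :: real
  \<comment> \<open>The quotient of consecutive terms: the product is the new factor at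
    \<open>i = k + 1\<close>, the rest comes from \<open>z ^ k / Gamma (A * k + b)\<close>, whose
    argument grows by \<open>A\<close> at each step.\<close>
  define r where "r k = (\<Prod>j = 1..n. q j (A * real (Suc k))) *
      (z * (Gamma (of_real (A * real k) + b) / Gamma (of_real (A * real k) + b + of_real A)))" for k
  have A: "A > 0"
    using pos[of "n + 1"] by (simp add: A_def)
  have lim: "filterlim (\<lambda>k. A * real k) at_top sequentially"
    "filterlim (\<lambda>k. A * real (Suc k)) at_top sequentially"
    using A by real_asymp+
  have q0: "(q j \<longlongrightarrow> 0) at_top" if "j \<in> {1..n}" for j
    using Gamma_ratio_tendsto_0[of "\<alpha> j" "wright_a \<alpha> \<nu> j"] pos[of j] that
    by (simp add: q_def[abs_def] wright_b_eq[of \<alpha>, OF assms(2)] add.assoc)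
  have "(\<lambda>k. \<Prod>j = 1..n. q j (A * real (Suc k))) \<longlonglongrightarrow> (\<Prod>j = 1..n. 0)"
    by (intro tendsto_prod filterlim_compose[OF q0 lim(2)])
  moreover have "(\<lambda>k. Gamma (of_real (A * real k) + b) / Gamma (of_real (A * real k) + b + of_real A))
      \<longlonglongrightarrow> 0"
    by (rule filterlim_compose[OF Gamma_ratio_tendsto_0[OF A] lim(1)])
  ultimately have "r \<longlonglongrightarrow> (\<Prod>j = 1..n. 0) * (z * 0)"
    unfolding r_def[abs_def] by (intro tendsto_mult tendsto_const)
  then have r0: "r \<longlonglongrightarrow> 0"
    by simp
  \<comment> \<open>At a pole \<open>Gamma (A * k + b)\<close> is 0 and could not be cancelled; a
    positive real part excludes this for large \<open>k\<close>. Poles in the \<open>q j\<close> do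
    no harm, since the same value stands on both sides of the recurrence.\<close>
  have "eventually (\<lambda>k. A * real k > - Re b) sequentially"
    using lim(1) by (auto simp: filterlim_at_top_dense)
  then have "eventually (\<lambda>k. wright_term n \<alpha> \<nu> z (Suc k) = r k * wright_term n \<alpha> \<nu> z k) sequentially"
  proof eventually_elim
    case (elim k)
    then have "of_real (A * real k) + b \<notin> \<int>\<^sub>\<le>\<^sub>0"
      by (auto elim!: nonpos_Ints_cases simp: complex_eq_iff)
    then have nz: "Gamma (of_real (A * real k) + b) \<noteq> 0"
      by (simp add: Gamma_eq_zero_iff)
    have wright_term_eq: "wright_term n \<alpha> \<nu> z m = (\<Prod>i = 1..m. \<Prod>j = 1..n. q j (A * real i)) *
        (z ^ m / Gamma (of_real (A * real m) + b))" for m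
      by (simp add: wright_term_def q_def A_def b_def)
    have shift: "of_real (A * real (Suc k)) + b = of_real (A * real k) + b + of_real A"
      by (simp add: algebra_simps)
    show ?case
      unfolding wright_term_eq r_def shift using nz by (simp del: of_real_mult of_nat_Suc)
  qed
  then show ?thesis
    using r0 by (rule summable_eventually_ratio)
qed

theorem lemma3p1:
  fixes n :: nat and \<alpha> :: "nat \<Rightarrow> real" and \<nu> :: "nat \<Rightarrow> complex"
  assumes "n \<ge> 1"
    and "\<And>m. 1 \<le> m \<Longrightarrow> m \<le> n + 1 \<Longrightarrow> \<alpha> m > 0"
    and "\<alpha> 0 = 0" and "\<nu> 0 = 0"
  shows "(\<forall>z. summable (wright_term n \<alpha> \<nu> z)) \<and> wright_W n \<alpha> \<nu> holomorphic_on UNIV"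
proof
  have summable: "summable (wright_term n \<alpha> \<nu> z)" for z
    using assms(2,3) by (rule summable_wright_term)
  then show "\<forall>z. summable (wright_term n \<alpha> \<nu> z)" ..
  \<comment> \<open>At \<open>z = 1\<close> the terms are the coefficients of the power series,
    which can be differentiated termwise since it converges everywhere.\<close>
  define c where "c = wright_term n \<alpha> \<nu> 1"
  have wright_term_eq: "wright_term n \<alpha> \<nu> z = (\<lambda>k. c k * z ^ k)" for z
    by (simp add: fun_eq_iff c_def wright_term_def)
  have "wright_W n \<alpha> \<nu> = (\<lambda>z. \<Sum>k. c k * z ^ k)"
    by (simp add: fun_eq_iff wright_W_def wright_term_eq)
  moreover have "((\<lambda>z. \<Sum>k. c k * z ^ k) has_field_derivative (\<Sum>k. diffs c k * z ^ k)) (at z)" for z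
    using summable by (intro termdiffs_strong_converges_everywhere) (simp add: wright_term_eq)
  ultimately show "wright_W n \<alpha> \<nu> holomorphic_on UNIV"
    by (metis field_differentiable_def holomorphic_onI)
qed

end
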